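(* Let $a, b, M > 0$, and let $f$ be a measurable function on $\mathbb{R}$ such that $$|f(x)| \leq M e^{-a x^2/2} \quad\text{and}\quad |\hat{f}(\xi)| \leq M e^{-b \xi^2/2}$$ for all $x, \xi \in \mathbb{R}$. If $ab \geq 4$, then $f = 0$ (almost everywhere, i.e. as an element of $L^2(\mathbb{R})$).
   Context: Functions are complex-valued. The Fourier transform is normalized as $$\hat{f}(\xi) = \mathcal{F} f(\xi) = \frac{1}{\sqrt{2\pi}} \lim_{N \to \infty} \int_{-N}^{N} e^{-i x \xi} f(x)\, dx,$$ the limit being taken in $L^2(\mathbb{R})$ (for $f$ satisfying the first bound, $f$ is integrable and square integrable, so $\hat f$ is also given pointwise by the absolutely convergent integral). *)

theory Defs
  imports "HOL-Analysis.Analysis"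
begin

definition truncated_fourier :: "(real \<Rightarrow> complex) \<Rightarrow> real \<Rightarrow> real \<Rightarrow> complex" where
  "truncated_fourier f N \<xi> =
     complex_of_real (1 / sqrt (2 * pi)) *
       (LINT x:{-N..N}|lebesgue. exp (- \<i> * complex_of_real (x * \<xi>)) * f x)"

definition square_integrable :: "(real \<Rightarrow> complex) \<Rightarrow> bool" where
  "square_integrable f \<longleftrightarrow>
     f \<in> borel_measurable lebesgue \<and> integrable lebesgue (\<lambda>x. (cmod (f x))\<^sup>2)"

text \<open>
  The limit is taken in the square mean, so a Fourier transform is determined only up to a null
  set. It is therefore a relation: \<open>g\<close> is some representative of the Fourier transform of \<open>f\<close>.
\<close>

definition has_fourier_transform ::
    "(real \<Rightarrow> complex) \<Rightarrow> (real \<Rightarrow> complex) \<Rightarrow> bool" where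
  "has_fourier_transform f g \<longleftrightarrow>
     square_integrable g \<and>
     ((\<lambda>N. \<integral>\<^sup>+ \<xi>. ennreal ((cmod (truncated_fourier f N \<xi> - g \<xi>))\<^sup>2) \<partial>lebesgue)
        \<longlongrightarrow> 0) at_top"

end

theory Submission
  imports Defs "HOL-Probability.Probability" "HOL-Complex_Analysis.Complex_Analysis"
begin

text \<open>
  The Fourier transform is tested against modulated Gaussians of variable width. Fix \<open>y\<close> and put
  \[ \phi(s) = \int f(x) e^{-ixy} e^{-s x^2/2} dx, \qquad
     \psi(t) = \int \hat f(\xi) e^{-t(\xi-y)^2/2} d\xi . \]
  The decay of \<open>f\<close> makes \<open>\<phi>\<close> holomorphic for \<open>\<bar>s\<bar> < a\<close>, and the decay of the transform makes \<open>\<psi>\<close>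
  holomorphic for \<open>\<bar>t\<bar> < b\<close> (\<open>holomorphic_exponential_integral\<close>). A Gaussian of width parameter
  \<open>t\<close> is transformed into one of parameter \<open>1/t\<close>, up to the factor \<open>t powr (-1/2)\<close>, so Fubini's
  theorem gives \<open>\<psi> (1/s) = sqrt s * \<phi> s\<close> for real \<open>s > 0\<close> in the common domain
  (\<open>fourier_gaussian_duality\<close>).

  The square root is the point. Both \<open>\<phi>\<close> and \<open>s \<mapsto> \<psi> (1/s)\<close> are single-valued on the annulus
  \<open>1/b < \<bar>s\<bar> < a\<close>, which is nonempty as soon as \<open>a * b > 1\<close>, whereas \<open>sqrt s\<close> changes sign
  around it; hence both vanish. The argument avoids branches by squaring: \<open>s * (\<phi> s)\<^sup>2\<close> inside and
  \<open>(\<psi> (1/s))\<^sup>2\<close> outside agree on the annulus and form a bounded entire function with a zero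
  at the origin, so Liouville's theorem makes it zero (\<open>zero_of_reciprocal_continuation\<close>). The value
  \<open>\<phi> 0\<close> is the Fourier transform at \<open>y\<close>, up to normalization. So the transform
  vanishes at every \<open>y\<close>, and \<open>f\<close> vanishes almost everywhere because integrable functions are determined
  by their Fourier transforms (\<open>fourier_integral_injective\<close>).

  The integrals are computed for a Borel representative of \<open>f\<close>, and Fatou's lemma identifies the
  transform in the square mean with the absolutely convergent integral
  (\<open>fourier_transform_eq_fourier_integral\<close>).
\<close>

section \<open>Gluing across an annulus\<close>

text \<open>
  The relation says that \<open>\<psi> (1/s)\<close> continues \<open>sqrt s * \<phi> s\<close> to infinity. The two squares glue to an
  entire function with a finite limit at infinity, hence to a constant; the factor \<open>s\<close> forces
  this constant to be zero.
\<close>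

lemma zero_of_reciprocal_continuation:
  fixes \<phi> \<psi> :: "complex \<Rightarrow> complex"
  assumes \<phi>: "\<phi> holomorphic_on ball 0 a" and \<psi>: "\<psi> holomorphic_on ball 0 b"
    and ab: "a > 0" "b > 0" "a * b > 1"
    and eq: "\<And>s::real. 1 / b < s \<Longrightarrow> s < a \<Longrightarrow>
      of_real s * (\<phi> (of_real s))\<^sup>2 = (\<psi> (1 / of_real s))\<^sup>2"
  shows "\<phi> 0 = 0"
proof -
  define A :: "complex set" where "A = {z. 1 / b < cmod (z - 0) \<and> cmod (z - 0) < a}"
  (* g is entire once its two branches are known to agree on the annulus A. *)
  define g where "g = (\<lambda>z. if z \<in> ball 0 a then z * (\<phi> z)\<^sup>2 else (\<psi> (1 / z))\<^sup>2)"
  have lt: "1 / b < a"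
    using ab by (simp add: field_simps)
  have outer: "(\<lambda>z. (\<psi> (1 / z))\<^sup>2) holomorphic_on - cball 0 (1 / b)"
  proof -
    have "(\<psi> \<circ> (\<lambda>z. 1 / z)) holomorphic_on - cball 0 (1 / b)"
      using ab by (intro holomorphic_on_compose_gen[OF _ \<psi>] holomorphic_intros)
        (auto simp: norm_divide divide_less_eq less_divide_eq not_le mult.commute)
    then show ?thesis
      by (auto simp: o_def intro: holomorphic_intros)
  qed
  have inner: "(\<lambda>z. z * (\<phi> z)\<^sup>2) holomorphic_on ball 0 a"
    by (intro holomorphic_intros \<phi>)
  have A_eq: "A = ball 0 a \<inter> - cball 0 (1 / b)"
    by (auto simp: A_def)
  obtain m where "1 / b < m" "m < a"
    using dense[OF lt] by blast
  moreover have "0 < 1 / b"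
    using ab by simp
  ultimately have m: "1 / b < m" "m < a" "0 < m"
    by linarith+
  have agree: "z * (\<phi> z)\<^sup>2 - (\<psi> (1 / z))\<^sup>2 = 0" if "z \<in> A" for z
  proof (rule analytic_continuation[where w = z and f = "\<lambda>z. z * (\<phi> z)\<^sup>2 - (\<psi> (1 / z))\<^sup>2" and S = A and U = "of_real ` {1/b<..<a}"
        and \<xi> = "of_real m"])
    show "(\<lambda>z. z * (\<phi> z)\<^sup>2 - (\<psi> (1 / z))\<^sup>2) holomorphic_on A"
      unfolding A_eq by (intro holomorphic_on_diff holomorphic_on_subset[OF inner] holomorphic_on_subset[OF outer]) auto
    show "open A"
      unfolding A_eq by auto
    show "connected A"
      unfolding A_def by (rule connected_annulus) simp
    show "of_real ` {1/b<..<a} \<subseteq> A"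
      using ab by (auto simp: A_def) (smt (verit) divide_pos_pos)+
    show "complex_of_real m \<in> A"
      unfolding A_def diff_0_right norm_of_real mem_Collect_eq using m by simp
    have "m islimpt {1/b<..<a}"
      using m by (intro interior_limit_point) auto
    then show "complex_of_real m islimpt of_real ` {1/b<..<a}"
      by (simp add: islimpt_isCont_image eventually_at_filter)
  qed (use eq that in auto)
  have "g holomorphic_on (ball 0 a \<union> - cball 0 (1 / b))"
    unfolding g_def using agree by (intro holomorphic_on_If_Un inner outer) (auto simp: A_eq)
  moreover have "ball 0 a \<union> - cball 0 (1 / b) = (UNIV :: complex set)"
    using lt by auto
  ultimately have entire: "g holomorphic_on UNIV"
    by simp
  have "(g \<longlongrightarrow> (\<psi> 0)\<^sup>2) at_infinity"
  proof (rule Lim_transform_eventually)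
    have "isCont \<psi> 0"
      using \<psi> ab holomorphic_on_imp_continuous_on continuous_on_interior by fastforce
    then show "((\<lambda>z. (\<psi> (1 / z))\<^sup>2) \<longlongrightarrow> (\<psi> 0)\<^sup>2) at_infinity"
      using tendsto_inverse_0 by (intro tendsto_power isCont_tendsto_compose[of _ \<psi>]) (simp_all add: divide_inverse)
    show "\<forall>\<^sub>F z in at_infinity. (\<psi> (1 / z))\<^sup>2 = g z"
      unfolding eventually_at_infinity g_def by (intro exI[of _ a]) auto
  qed
  from Liouville_weak[OF entire this] have const: "g z = (\<psi> 0)\<^sup>2" for z .
  have "g 0 = 0"
    using ab by (simp add: g_def)
  then have g_zero: "g z = 0" for z
    using const[of 0] const[of z] by simp
  have zero: "\<phi> z = 0" if "z \<in> ball 0 a" "z \<noteq> 0" for z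
    using g_zero[of z] that by (simp add: g_def)
  have "isCont \<phi> 0"
    using \<phi> ab holomorphic_on_imp_continuous_on continuous_on_interior by fastforce
  then have "(\<phi> \<longlongrightarrow> \<phi> 0) (at 0)"
    by (simp add: isCont_def)
  moreover have "(\<phi> \<longlongrightarrow> 0) (at 0)"
  proof (rule tendsto_eventually)
    show "\<forall>\<^sub>F z in at 0. \<phi> z = 0"
      using ab zero by (auto simp: eventually_at dist_norm intro!: exI[of _ a])
  qed
  ultimately show ?thesis
    using tendsto_unique at_neq_bot by blast
qed

section \<open>Exponential integrals as power series\<close>

text \<open>
  Expanding the exponential and integrating term by term gives a power series in \<open>s\<close>: the partial
  sums of the absolute values are dominated by the integrand at \<open>\<rho> = \<bar>s\<bar>\<close>.
\<close>

lemma holomorphic_exponential_integral: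
  fixes h :: "'a \<Rightarrow> complex" and q :: "'a \<Rightarrow> real"
  assumes [measurable]: "h \<in> borel_measurable M" "q \<in> borel_measurable M"
    and nonneg: "\<And>x. q x \<ge> 0"
    and int: "\<And>\<rho>. 0 \<le> \<rho> \<Longrightarrow> \<rho> < R \<Longrightarrow> integrable M (\<lambda>x. cmod (h x) * exp (\<rho> * q x))"
  shows "(\<lambda>s. LINT x|M. h x * exp (- (s * of_real (q x)))) holomorphic_on ball 0 R"
proof (rule power_series_holomorphic)
  fix s :: complex assume s: "s \<in> ball 0 R"
  define u where "u = (\<lambda>(n::nat) x. h x * ((- (s * of_real (q x))) ^ n /\<^sub>R fact n))"
  define v where "v = (\<lambda>(n::nat) x. cmod (h x) * ((cmod s * q x) ^ n /\<^sub>R fact n))"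
  have uv: "cmod (u n x) = v n x" for n x
    using nonneg by (simp add: u_def v_def norm_mult norm_power)
  have v_sums: "(\<lambda>n::nat. v n x) sums (cmod (h x) * exp (cmod s * q x))" for x
    unfolding v_def by (intro sums_mult exp_converges)
  have v_nonneg: "v n x \<ge> 0" for n x
    using uv[of n x] norm_ge_zero by metis
  have E: "integrable M (\<lambda>x. cmod (h x) * exp (cmod s * q x))"
    using s by (intro int) auto
  have part: "(\<Sum>i<n. v i x) \<le> cmod (h x) * exp (cmod s * q x)" for n x
    using sum_le_suminf[OF sums_summable[OF v_sums[of x]], of "{..<n}"] v_nonneg sums_unique[OF v_sums[of x]] by auto
  have v_le: "v n x \<le> cmod (h x) * exp (cmod s * q x)" for n x
    using part[where n = "Suc n" and x = x] sum_nonneg[of "{..<n}" "\<lambda>i. v i x"] v_nonneg by force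
  have [measurable]: "u n \<in> borel_measurable M" "v n \<in> borel_measurable M" for n
    unfolding u_def v_def by measurable
  have u_int: "integrable M (u n)" for n
    by (rule Bochner_Integration.integrable_bound[OF E]) (auto simp: uv intro!: AE_I2 order_trans[OF v_le])
  have v_int: "integrable M (v n)" for n
    using integrable_norm[OF u_int[of n]] by (simp add: uv)
  have "(\<lambda>n. LINT x|M. u n x) sums (LINT x|M. (\<Sum>n. u n x))"
  proof (rule sums_integral[OF u_int])
    show "AE x in M. summable (\<lambda>n. norm (u n x))"
      using v_sums by (auto simp: uv sums_iff)
    show "summable (\<lambda>n. LINT x|M. norm (u n x))"
    proof (rule bounded_imp_summable)
      show "0 \<le> (LINT x|M. norm (u n x))" for n
        by simp
      show "(\<Sum>n\<le>N. LINT x|M. norm (u n x)) \<le> (LINT x|M. cmod (h x) * exp (cmod s * q x))" for N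
        using part[where n = "Suc N"] unfolding uv lessThan_Suc_atMost
        by (subst Bochner_Integration.integral_sum[symmetric]) (auto intro!: integral_mono E v_int)
    qed
  qed
  also have "(\<lambda>x. \<Sum>n. u n x) = (\<lambda>x. h x * exp (- (s * of_real (q x))))"
    unfolding u_def using sums_unique[OF sums_mult[OF exp_converges]] by (metis (no_types))
  also have "(\<lambda>n. LINT x|M. u n x) =
      (\<lambda>n. (LINT x|M. h x * ((- of_real (q x)) ^ n /\<^sub>R fact n)) * (s - 0) ^ n)"
  proof
    fix n
    have "u n = (\<lambda>x. (h x * ((- of_real (q x)) ^ n /\<^sub>R fact n)) * (s - 0) ^ n)"
      by (auto simp: u_def power_mult_distrib power_minus[of "_ * _"] power_minus[of "of_real _"] scaleR_conv_of_real)
    then show "(LINT x|M. u n x) = (LINT x|M. h x * ((- of_real (q x)) ^ n /\<^sub>R fact n)) * (s - 0) ^ n"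
      by simp
  qed
  finally show "(\<lambda>n. (LINT x|M. h x * ((- of_real (q x)) ^ n /\<^sub>R fact n)) * (s - 0) ^ n) sums
      (LINT x|M. h x * exp (- (s * of_real (q x))))" .
qed

section \<open>Gaussians and Fourier duality\<close>

lemma integrable_gaussian_linear:
  fixes c d :: real
  assumes "c > 0"
  shows "integrable lborel (\<lambda>x. exp (- (c * x\<^sup>2) + d * x))"
proof -
  define \<sigma> where "\<sigma> = 1 / sqrt (2 * c)"
  have \<sigma>: "\<sigma>\<^sup>2 = 1 / (2 * c)"
    using assms by (simp add: \<sigma>_def power_divide)
  have "\<sigma> > 0"
    using assms by (simp add: \<sigma>_def)
  have "exp (- (c * x\<^sup>2) + d * x) =
      (exp (d\<^sup>2 / (4 * c)) * sqrt (2 * pi * \<sigma>\<^sup>2)) * normal_density (d / (2 * c)) \<sigma> x" for x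
  proof -
    have "- (c * x\<^sup>2) + d * x = d\<^sup>2 / (4 * c) + - (x - d / (2 * c))\<^sup>2 / (2 * \<sigma>\<^sup>2)"
      unfolding \<sigma> using assms by (simp add: power2_eq_square field_simps)
    then show ?thesis
      using \<open>\<sigma> > 0\<close> by (simp only: exp_add normal_density_def) simp
  qed
  with \<open>\<sigma> > 0\<close> show ?thesis
    by simp
qed

text \<open>
  Translating by \<open>y\<close> and scaling by \<open>sqrt t\<close> reduces this to the characteristic function of the
  standard normal distribution.
\<close>

lemma fourier_gaussian:
  fixes t x y :: real
  assumes "t > 0"
  shows "(LINT \<xi>|lborel. exp (- \<i> * of_real (x * \<xi>)) * of_real (exp (- (t * ((\<xi> - y)\<^sup>2 / 2))))) =
    of_real (sqrt (2 * pi) / sqrt t * exp (- (x\<^sup>2 / (2 * t)))) * exp (- \<i> * of_real (x * y))"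
    (is "(LINT \<xi>|lborel. ?g \<xi>) = _")
proof -
  (* The frequency seen by the standardized variable z = sqrt t (xi - y). *)
  define u where "u = - x / sqrt t"
  have gauss: "complex_of_real (exp (- (u\<^sup>2) / 2)) = (LINT z|lborel. std_normal_density z *\<^sub>R iexp (u * z))"
    using char_std_normal_distribution[THEN fun_cong, of u] by (simp add: char_def integral_density)
  define w where "w = complex_of_real (sqrt (2 * pi)) * exp (- \<i> * of_real (x * y))"
  have shift: "?g (y + 1 / sqrt t * z) = w * (std_normal_density z *\<^sub>R iexp (u * z))" for z
  proof -
    have "t * ((y + 1 / sqrt t * z - y)\<^sup>2 / 2) = z\<^sup>2 / 2"
      using assms by (simp add: power_mult_distrib power_divide)
    moreover have "exp (- \<i> * of_real (x * (y + 1 / sqrt t * z))) = exp (- \<i> * of_real (x * y)) * iexp (u * z)"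
      by (simp add: u_def exp_add[symmetric] algebra_simps)
    ultimately show ?thesis
      by (simp add: std_normal_density_def scaleR_conv_of_real w_def)
  qed
  have "(LINT \<xi>|lborel. ?g \<xi>) = \<bar>1 / sqrt t\<bar> *\<^sub>R (LINT z|lborel. ?g (y + 1 / sqrt t * z))"
    using assms by (intro lborel_integral_real_affine) auto
  also have "\<dots> = \<bar>1 / sqrt t\<bar> *\<^sub>R (w * of_real (exp (- (u\<^sup>2) / 2)))"
    unfolding shift gauss integral_mult_right_zero ..
  also have "u\<^sup>2 = x\<^sup>2 / t"
    using assms by (simp add: u_def power_divide)
  finally show ?thesis
    using assms by (simp add: scaleR_conv_of_real w_def mult_ac)
qed

text \<open>
  Unlike the transform in the square mean, which is determined only up to a null set, this is a
  function with a value at every point.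
\<close>

definition fourier_integral :: "(real \<Rightarrow> complex) \<Rightarrow> real \<Rightarrow> complex" where
  "fourier_integral f \<xi> =
    complex_of_real (1 / sqrt (2 * pi)) * (LINT x|lborel. exp (- \<i> * of_real (x * \<xi>)) * f x)"

text \<open>
  This is the multiplication formula of Fourier theory (moving the transform from one factor of an
  integral to the other) for a Gaussian. The factor \<open>1 / sqrt t\<close> is what the main argument exploits.
\<close>

lemma fourier_gaussian_duality:
  assumes f: "integrable lborel f" and t: "t > 0"
  shows "(LINT \<xi>|lborel. fourier_integral f \<xi> * of_real (exp (- (t * ((\<xi> - y)\<^sup>2 / 2))))) =
    of_real (1 / sqrt t) *
      (LINT x|lborel. exp (- \<i> * of_real (x * y)) * f x * of_real (exp (- (x\<^sup>2 / (2 * t)))))"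
proof -
  define G where "G = (\<lambda>\<xi>. exp (- (t * ((\<xi> - y)\<^sup>2 / 2))))"
  define k where "k = (\<lambda>x \<xi>. exp (- \<i> * of_real (x * \<xi>)) * f x * of_real (G \<xi>))"
  have [measurable]: "f \<in> borel_measurable borel"
    using f by auto
  have [measurable]: "G \<in> borel_measurable borel"
    unfolding G_def by measurable
  have G: "integrable lborel G"
  proof -
    have "G = (\<lambda>\<xi>. exp (- (t * y\<^sup>2 / 2)) * exp (- (t / 2 * \<xi>\<^sup>2) + t * y * \<xi>))"
      by (auto simp: G_def exp_add[symmetric] power2_eq_square field_simps)
    then show ?thesis
      using integrable_gaussian_linear[of "t / 2" "t * y"] t by simp
  qed
  have norm_k: "cmod (k x \<xi>) = cmod (f x) * G \<xi>" for x \<xi>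
    by (simp add: k_def norm_mult G_def)
  have km [measurable]: "case_prod k \<in> borel_measurable (lborel \<Otimes>\<^sub>M lborel)"
    unfolding k_def by measurable
  have "integrable (lborel \<Otimes>\<^sub>M lborel) (case_prod k)"
  proof (rule lborel_pair.Fubini_integrable[OF km])
    show "integrable lborel (\<lambda>x. LINT \<xi>|lborel. norm (case_prod k (x, \<xi>)))"
      using f by (simp add: norm_k)
    show "AE x in lborel. integrable lborel (\<lambda>\<xi>. case_prod k (x, \<xi>))"
    proof (rule AE_I2)
      fix x
      show "integrable lborel (\<lambda>\<xi>. case_prod k (x, \<xi>))"
        by (rule Bochner_Integration.integrable_bound[where f = "\<lambda>\<xi>. cmod (f x) * G \<xi>"])
          (use G in \<open>auto simp: norm_k G_def\<close>)
    qed
  qed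
  then have fub: "(LINT \<xi>|lborel. LINT x|lborel. k x \<xi>) = (LINT x|lborel. LINT \<xi>|lborel. k x \<xi>)"
    by (rule lborel_pair.Fubini_integral)
  have inner: "(LINT \<xi>|lborel. k x \<xi>) = of_real (sqrt (2 * pi) / sqrt t) *
      (exp (- \<i> * of_real (x * y)) * f x * of_real (exp (- (x\<^sup>2 / (2 * t)))))" for x
  proof -
    have "(LINT \<xi>|lborel. k x \<xi>) = f x * (LINT \<xi>|lborel. exp (- \<i> * of_real (x * \<xi>)) * of_real (G \<xi>))"
      unfolding k_def by (subst integral_mult_right_zero[symmetric]) (simp add: mult_ac)
    also have "\<dots> = f x * (of_real (sqrt (2 * pi) / sqrt t * exp (- (x\<^sup>2 / (2 * t)))) * exp (- \<i> * of_real (x * y)))"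
      unfolding G_def fourier_gaussian[OF t] ..
    finally show ?thesis
      by (simp add: mult_ac)
  qed
  have outer: "fourier_integral f \<xi> * of_real (G \<xi>) =
      of_real (1 / sqrt (2 * pi)) * (LINT x|lborel. k x \<xi>)" for \<xi>
    unfolding k_def fourier_integral_def by simp
  have "(LINT \<xi>|lborel. fourier_integral f \<xi> * of_real (G \<xi>)) =
      of_real (1 / sqrt (2 * pi)) * (LINT x|lborel. LINT \<xi>|lborel. k x \<xi>)"
    unfolding outer integral_mult_right_zero fub ..
  also have "\<dots> = of_real (1 / sqrt (2 * pi)) * (of_real (sqrt (2 * pi) / sqrt t) *
      (LINT x|lborel. exp (- \<i> * of_real (x * y)) * f x * of_real (exp (- (x\<^sup>2 / (2 * t))))))"
    unfolding inner integral_mult_right_zero ..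
  also have "of_real (1 / sqrt (2 * pi)) * (of_real (sqrt (2 * pi) / sqrt t) * c) = of_real (1 / sqrt t) * c"
    for c :: complex
    by (simp flip: of_real_mult mult.assoc)
  finally show ?thesis
    by (simp only: G_def)
qed

section \<open>Uniqueness of Fourier transforms\<close>

text \<open>
  The positive and negative parts of \<open>g\<close> have the same total mass \<open>m\<close>, by evaluating at \<open>t = 0\<close>.
  Unless \<open>m = 0\<close>, dividing by \<open>m\<close> turns them into densities of two probability distributions with
  the same characteristic function, and Levy's uniqueness theorem applies.
\<close>

lemma real_fourier_injective:
  fixes g :: "real \<Rightarrow> real"
  assumes g: "integrable lborel g" and zero: "\<And>t. (LINT x|lborel. g x *\<^sub>R iexp (t * x)) = 0"
  shows "AE x in lborel. g x = 0"
proof -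
  have [measurable]: "g \<in> borel_measurable borel"
    using g by auto
  define p where "p = (\<lambda>x. max 0 (g x))"
  define n where "n = (\<lambda>x. max 0 (- g x))"
  define m where "m = (LINT x|lborel. p x)"
  have [measurable]: "p \<in> borel_measurable borel" "n \<in> borel_measurable borel"
    unfolding p_def n_def by measurable
  have p: "integrable lborel p" and n: "integrable lborel n"
    unfolding p_def n_def using g by auto
  have nonneg: "p x \<ge> 0" "n x \<ge> 0" and diff: "g x = p x - n x" for x
    by (auto simp: p_def n_def)
  have iexp_int: "integrable lborel (\<lambda>x. k x *\<^sub>R iexp (t * x))" if k: "integrable lborel k" for k :: "real \<Rightarrow> real" and t
    by (rule Bochner_Integration.integrable_bound[OF k]) (use k in auto)
  have eq: "(LINT x|lborel. p x *\<^sub>R iexp (t * x)) = (LINT x|lborel. n x *\<^sub>R iexp (t * x))" for t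
    using zero[of t] unfolding diff scaleR_diff_left
    by (subst (asm) Bochner_Integration.integral_diff[OF iexp_int[OF p] iexp_int[OF n]]) simp
  from eq[of 0] have m: "(LINT x|lborel. n x) = m"
    by (simp add: m_def scaleR_conv_of_real)
  show ?thesis
  proof (cases "m = 0")
    case True
    then have "AE x in lborel. p x = 0" "AE x in lborel. n x = 0"
      using integral_nonneg_eq_0_iff_AE[OF p] integral_nonneg_eq_0_iff_AE[OF n] nonneg m m_def by auto
    then show ?thesis
      by eventually_elim (simp add: diff)
  next
    case False
    then have "m > 0"
      using Bochner_Integration.integral_nonneg[of lborel p] nonneg by (simp add: m_def less_le)
    define D where "D = (\<lambda>k::real \<Rightarrow> real. density lborel (\<lambda>x. ennreal (k x / m)))"
    have dist: "real_distribution (D k)"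
      if "integrable lborel k" "\<And>x. k x \<ge> 0" "(LINT x|lborel. k x) = m" for k
    proof -
      have [measurable]: "k \<in> borel_measurable borel"
        using that by auto
      have "emeasure (D k) (space (D k)) = (\<integral>\<^sup>+x. ennreal (k x / m) \<partial>lborel)"
        by (simp add: D_def emeasure_density)
      also have "\<dots> = ennreal (LINT x|lborel. k x / m)"
        using that \<open>m > 0\<close> by (intro nn_integral_eq_integral) auto
      also have "\<dots> = 1"
        using that \<open>m > 0\<close> by simp
      finally show ?thesis
        by (auto simp: real_distribution_def real_distribution_axioms_def D_def intro!: prob_spaceI)
    qed
    have ch: "char (D k) t = (LINT x|lborel. k x *\<^sub>R iexp (t * x)) /\<^sub>R m"
      if "integrable lborel k" "\<And>x. k x \<ge> 0" for k t
    proof -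
      have [measurable]: "k \<in> borel_measurable borel"
        using that by auto
      show ?thesis
        unfolding char_def D_def using that \<open>m > 0\<close>
        by (subst integral_density) (auto simp: divide_inverse mult.commute simp flip: scaleR_scaleR)
    qed
    have "D p = D n"
    proof (rule Levy_uniqueness)
      show "real_distribution (D p)" "real_distribution (D n)"
        using p n nonneg m by (auto intro!: dist simp: m_def)
      show "char (D p) = char (D n)"
        by (simp only: fun_eq_iff ch[OF p nonneg(1)] ch[OF n nonneg(2)] eq) simp
    qed
    moreover have "(\<integral>\<^sup>+x. ennreal (p x / m) \<partial>lborel) \<noteq> \<infinity>"
      using nn_integral_eq_integral[of lborel "\<lambda>x. p x / m"] p nonneg \<open>m > 0\<close> by auto
    ultimately have "AE x in lborel. ennreal (p x / m) = ennreal (n x / m)"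
      unfolding D_def by (subst (asm) finite_density_unique) auto
    then show ?thesis
      by eventually_elim (use nonneg \<open>m > 0\<close> in \<open>auto simp: diff\<close>)
  qed
qed

text \<open>
  The transform of the conjugate of \<open>f\<close> is the reflected conjugate of the transform of \<open>f\<close>, so it vanishes
  too, and with it the transforms of the real and imaginary parts.
\<close>

lemma fourier_integral_injective:
  assumes f: "integrable lborel f" and zero: "\<And>\<xi>. fourier_integral f \<xi> = 0"
  shows "AE x in lborel. f x = 0"
proof -
  have i1: "(LINT x|lborel. iexp (t * x) * f x) = 0" for t
    using zero[of "- t"] by (simp add: fourier_integral_def mult.commute)
  have i2: "(LINT x|lborel. iexp (t * x) * cnj (f x)) = 0" for t
  proof -
    have "(LINT x|lborel. iexp (t * x) * cnj (f x)) = cnj (LINT x|lborel. iexp (- t * x) * f x)"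
      unfolding complex_cnj_mult exp_cnj Bochner_Integration.integral_cnj[symmetric] by simp
    then show ?thesis
      by (simp only: i1) simp
  qed
  have [measurable]: "f \<in> borel_measurable borel"
    using f by auto
  have [measurable]: "cnj \<in> borel_measurable borel"
    by (intro borel_measurable_continuous_onI continuous_intros)
  have int: "integrable lborel (\<lambda>x. iexp (t * x) * f x)" 
     "integrable lborel (\<lambda>x. iexp (t * x) * cnj (f x))" for t
    by (rule Bochner_Integration.integrable_bound[OF f]; auto simp: norm_mult)+
  have "AE x in lborel. Re (f x) = 0"
  proof (rule real_fourier_injective)
    fix t
    have "Re (f x) *\<^sub>R iexp (t * x) = (iexp (t * x) * f x + iexp (t * x) * cnj (f x)) / 2" for x
      by (simp add: complex_eq_iff algebra_simps)
    then show "(LINT x|lborel. Re (f x) *\<^sub>R iexp (t * x)) = 0"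
      by (simp only: integral_divide_zero Bochner_Integration.integral_add[OF int] i1 i2) simp
  qed (use f in simp)
  moreover have "AE x in lborel. Im (f x) = 0"
  proof (rule real_fourier_injective)
    fix t
    have "Im (f x) *\<^sub>R iexp (t * x) = (iexp (t * x) * f x - iexp (t * x) * cnj (f x)) / (2 * \<i>)" for x
      by (simp add: complex_eq_iff algebra_simps Re_divide Im_divide power2_eq_square)
    then show "(LINT x|lborel. Im (f x) *\<^sub>R iexp (t * x)) = 0"
      by (simp only: integral_divide_zero Bochner_Integration.integral_diff[OF int] i1 i2) simp
  qed (use f in simp)
  ultimately show ?thesis
    by eventually_elim (simp add: complex_eq_iff)
qed

section \<open>Hardy's uncertainty principle\<close>

lemma borel_measurable_fourier_integral [measurable]:
  assumes [measurable]: "f \<in> borel_measurable borel"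
  shows "fourier_integral f \<in> borel_measurable borel"
  unfolding fourier_integral_def by measurable

text \<open>
  The Gaussian bounds are what makes the two exponential integrals holomorphic on discs of radius
  \<open>a\<close> and \<open>b\<close>; the duality formula is then exactly the hypothesis of the gluing lemma with \<open>t = 1/s\<close>.
\<close>

lemma hardy_uncertainty_borel:
  assumes ab: "a > 0" "b > 0" "a * b > 1"
    and f [measurable]: "f \<in> borel_measurable borel"
    and f_le: "AE x in lborel. cmod (f x) \<le> M * exp (- a * x\<^sup>2 / 2)"
    and F_le: "AE \<xi> in lborel. cmod (fourier_integral f \<xi>) \<le> M * exp (- b * \<xi>\<^sup>2 / 2)"
  shows "AE x in lborel. f x = 0"
proof -
  have f_int: "integrable lborel (\<lambda>x. cmod (f x) * exp (\<rho> * (x\<^sup>2 / 2)))" if "\<rho> < a" for \<rho>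
  proof (rule Bochner_Integration.integrable_bound)
    show "integrable lborel (\<lambda>x. M * exp (- ((a - \<rho>) / 2 * x\<^sup>2) + 0 * x))"
      using that by (intro integrable_mult_right integrable_gaussian_linear) simp
    show "AE x in lborel. norm (cmod (f x) * exp (\<rho> * (x\<^sup>2 / 2))) \<le> norm (M * exp (- ((a - \<rho>) / 2 * x\<^sup>2) + 0 * x))"
      using f_le
    proof eventually_elim
      case (elim x)
      then have "cmod (f x) * exp (\<rho> * (x\<^sup>2 / 2)) \<le> M * exp (- a * x\<^sup>2 / 2) * exp (\<rho> * (x\<^sup>2 / 2))"
        by (intro mult_right_mono) auto
      also have "\<dots> = M * exp (- ((a - \<rho>) / 2 * x\<^sup>2) + 0 * x)"
        by (simp add: mult.assoc exp_add[symmetric]) (simp add: field_simps)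
      finally show ?case
        by simp
    qed
  qed measurable
  have F_int: "integrable lborel (\<lambda>\<xi>. cmod (fourier_integral f \<xi>) * exp (\<rho> * ((\<xi> - y)\<^sup>2 / 2)))"
    if "\<rho> < b" for \<rho> y
  proof (rule Bochner_Integration.integrable_bound)
    show "integrable lborel (\<lambda>\<xi>. M * exp (\<rho> * y\<^sup>2 / 2) * exp (- ((b - \<rho>) / 2 * \<xi>\<^sup>2) + (- \<rho> * y) * \<xi>))"
      using that by (intro integrable_mult_right integrable_gaussian_linear) simp
    show "AE \<xi> in lborel. norm (cmod (fourier_integral f \<xi>) * exp (\<rho> * ((\<xi> - y)\<^sup>2 / 2)))
        \<le> norm (M * exp (\<rho> * y\<^sup>2 / 2) * exp (- ((b - \<rho>) / 2 * \<xi>\<^sup>2) + (- \<rho> * y) * \<xi>))"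
      using F_le
    proof eventually_elim
      case (elim \<xi>)
      then have "cmod (fourier_integral f \<xi>) * exp (\<rho> * ((\<xi> - y)\<^sup>2 / 2))
          \<le> M * exp (- b * \<xi>\<^sup>2 / 2) * exp (\<rho> * ((\<xi> - y)\<^sup>2 / 2))"
        by (intro mult_right_mono) auto
      also have "\<dots> = M * exp (\<rho> * y\<^sup>2 / 2) * exp (- ((b - \<rho>) / 2 * \<xi>\<^sup>2) + (- \<rho> * y) * \<xi>)"
        by (simp add: mult.assoc exp_add[symmetric]) (simp add: field_simps power2_eq_square)
      finally show ?case
        by simp
    qed
  qed measurable
  have f_integrable: "integrable lborel f"
    using f_int[of 0] ab by (simp add: integrable_norm_iff)
  show ?thesis
  proof (rule fourier_integral_injective[OF f_integrable])
    fix y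
    define \<phi> where "\<phi> = (\<lambda>s. LINT x|lborel. exp (- \<i> * of_real (x * y)) * f x * exp (- (s * of_real (x\<^sup>2 / 2))))"
    define \<psi> where "\<psi> = (\<lambda>t. LINT \<xi>|lborel. fourier_integral f \<xi> * exp (- (t * of_real ((\<xi> - y)\<^sup>2 / 2))))"
    (* phi 0 is the Fourier integral at y up to the factor sqrt (2 pi). *)
    have "\<phi> 0 = 0"
    proof (rule zero_of_reciprocal_continuation[of \<phi> a \<psi> b])
      show "\<phi> holomorphic_on ball 0 a"
        unfolding \<phi>_def using f_int by (intro holomorphic_exponential_integral) (auto simp: norm_mult)
      show "\<psi> holomorphic_on ball 0 b"
        unfolding \<psi>_def using F_int by (intro holomorphic_exponential_integral) auto
      fix s :: real assume "1 / b < s"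
      moreover have "0 < 1 / b"
        using ab by simp
      ultimately have s: "s > 0"
        by linarith
      have "\<psi> (1 / of_real s) =
          (LINT \<xi>|lborel. fourier_integral f \<xi> * of_real (exp (- (1 / s * ((\<xi> - y)\<^sup>2 / 2)))))"
        unfolding \<psi>_def by (simp add: exp_of_real[symmetric])
      also have "\<dots> = of_real (sqrt s) * \<phi> (of_real s)"
        using s fourier_gaussian_duality[OF f_integrable, of "1 / s" y]
        by (simp add: \<phi>_def exp_of_real[symmetric] real_sqrt_divide mult.commute)
      finally show "of_real s * (\<phi> (of_real s))\<^sup>2 = (\<psi> (1 / of_real s))\<^sup>2"
        using s by (simp add: power_mult_distrib flip: of_real_power)
    qed (use ab in auto)
    then show "fourier_integral f y = 0"
      by (simp add: \<phi>_def fourier_integral_def)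
  qed
qed

text \<open>
  The truncated integrals converge pointwise to the full one by dominated convergence, and in the
  square mean to \<open>fhat\<close>. Fatou's lemma bounds the square-mean distance of the two limits by zero.
\<close>

lemma fourier_transform_eq_fourier_integral:
  assumes ft: "has_fourier_transform f fhat"
    and f [measurable]: "f \<in> borel_measurable lebesgue"
    and g: "integrable lborel g" and fg: "AE x in lborel. f x = g x"
  shows "AE \<xi> in lborel. fhat \<xi> = fourier_integral g \<xi>"
proof -
  have [measurable]: "g \<in> borel_measurable borel"
    using g by auto
  have [measurable]: "fhat \<in> borel_measurable lebesgue"
    using ft by (auto simp: has_fourier_transform_def square_integrable_def)
  have trunc: "truncated_fourier f N = fourier_integral (\<lambda>x. indicator {-N..N} x *\<^sub>R g x)" for N
  proof
    fix \<xi>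
    have "(LINT x:{-N..N}|lebesgue. exp (- \<i> * of_real (x * \<xi>)) * f x) =
        (LINT x|lebesgue. exp (- \<i> * of_real (x * \<xi>)) * (indicator {-N..N} x *\<^sub>R g x))"
      unfolding set_lebesgue_integral_def
    proof (rule integral_cong_AE)
      show "AE x in lebesgue. indicator {-N..N} x *\<^sub>R (exp (- \<i> * of_real (x * \<xi>)) * f x) =
          exp (- \<i> * of_real (x * \<xi>)) * (indicator {-N..N} x *\<^sub>R g x)"
        using AE_completion[OF fg] by eventually_elim simp
      have [measurable]: "g \<in> borel_measurable lebesgue" "(\<lambda>x. x) \<in> borel_measurable lebesgue"
        by (rule measurable_completion, simp)+
      show "(\<lambda>x. indicator {-N..N} x *\<^sub>R (exp (- \<i> * of_real (x * \<xi>)) * f x)) \<in> borel_measurable lebesgue"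
        "(\<lambda>x. exp (- \<i> * of_real (x * \<xi>)) * (indicator {-N..N} x *\<^sub>R g x)) \<in> borel_measurable lebesgue"
        by measurable
    qed
    also have "\<dots> = (LINT x|lborel. exp (- \<i> * of_real (x * \<xi>)) * (indicator {-N..N} x *\<^sub>R g x))"
      by (rule integral_completion) measurable
    finally show "truncated_fourier f N \<xi> = fourier_integral (\<lambda>x. indicator {-N..N} x *\<^sub>R g x) \<xi>"
      by (simp add: truncated_fourier_def fourier_integral_def)
  qed
  have meas [measurable]: "truncated_fourier f N \<in> borel_measurable lebesgue" for N
    unfolding trunc by (rule measurable_completion) simp
  have lim: "(\<lambda>n. truncated_fourier f (real n) \<xi>) \<longlonglongrightarrow> fourier_integral g \<xi>" for \<xi>
    unfolding trunc fourier_integral_def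
  proof (intro tendsto_mult_left integral_dominated_convergence[where w = "\<lambda>x. cmod (g x)"])
    show "AE x in lborel. (\<lambda>n. exp (- \<i> * of_real (x * \<xi>)) * (indicator {- real n..real n} x *\<^sub>R g x))
        \<longlonglongrightarrow> exp (- \<i> * of_real (x * \<xi>)) * g x"
    proof (rule AE_I2, rule tendsto_eventually)
      fix x
      show "\<forall>\<^sub>F n in sequentially. exp (- \<i> * of_real (x * \<xi>)) * (indicator {- real n..real n} x *\<^sub>R g x)
          = exp (- \<i> * of_real (x * \<xi>)) * g x"
        using eventually_ge_at_top[of "nat \<lceil>\<bar>x\<bar>\<rceil>"]
      proof eventually_elim
        case (elim n)
        then have "x \<in> {- real n..real n}"
          by auto
        then show ?case
          by simp
      qed
    qed
  qed (use g in \<open>auto simp: norm_mult indicator_def\<close>)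
  define e where "e = (\<lambda>n \<xi>. ennreal ((cmod (truncated_fourier f (real n) \<xi> - fhat \<xi>))\<^sup>2))"
  have e_meas [measurable]: "e n \<in> borel_measurable lebesgue" for n
    unfolding e_def by measurable
  have "(\<lambda>n. \<integral>\<^sup>+ \<xi>. e n \<xi> \<partial>lebesgue) \<longlonglongrightarrow> 0"
    unfolding e_def using ft filterlim_compose[OF _ filterlim_real_sequentially] 
    by (auto simp: has_fourier_transform_def)
  then have "(\<integral>\<^sup>+ \<xi>. liminf (\<lambda>n. e n \<xi>) \<partial>lebesgue) = 0"
    using nn_integral_liminf[of e lebesgue] by (simp add: lim_imp_Liminf)
  moreover have "liminf (\<lambda>n. e n \<xi>) = ennreal ((cmod (fourier_integral g \<xi> - fhat \<xi>))\<^sup>2)" for \<xi>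
    unfolding e_def by (intro lim_imp_Liminf tendsto_intros lim) simp
  moreover have "fourier_integral g \<in> borel_measurable lebesgue"
    by (rule measurable_completion) simp
  ultimately have "AE \<xi> in lebesgue. ennreal ((cmod (fourier_integral g \<xi> - fhat \<xi>))\<^sup>2) = 0"
    by (subst (asm) nn_integral_0_iff_AE) auto
  then show ?thesis
    unfolding AE_completion_iff by eventually_elim (auto simp: ennreal_eq_0_iff)
qed

theorem theorem1p2:
  fixes a b M :: real and f fhat :: "real \<Rightarrow> complex"
  assumes "a > 0" and "b > 0" and "M > 0"
    and "f \<in> borel_measurable lebesgue"
    and "has_fourier_transform f fhat"
    and "\<And>x. cmod (f x) \<le> M * exp (- a * x\<^sup>2 / 2)"
    and "\<And>\<xi>. cmod (fhat \<xi>) \<le> M * exp (- b * \<xi>\<^sup>2 / 2)"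
    and "a * b \<ge> 4"
  shows "AE x in lebesgue. f x = 0"
proof -
  have "(\<lambda>x. Re (f x)) \<in> borel_measurable lebesgue" "(\<lambda>x. Im (f x)) \<in> borel_measurable lebesgue"
    using assms(4) by measurable
  then obtain u v where uv [measurable]: "u \<in> borel_measurable lborel" "v \<in> borel_measurable lborel"
    and ae: "AE x in lborel. Re (f x) = u x" "AE x in lborel. Im (f x) = v x"
    using completion_ex_borel_measurable_real by metis
  define g where "g = (\<lambda>x. Complex (u x) (v x))"
  have g [measurable]: "g \<in> borel_measurable borel"
    unfolding g_def Complex_eq by measurable
  have fg: "AE x in lborel. f x = g x"
    using ae by eventually_elim (simp add: g_def complex_eq_iff)
  then have g_le: "AE x in lborel. cmod (g x) \<le> M * exp (- a * x\<^sup>2 / 2)"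
    by eventually_elim (metis assms(6))
  have "integrable lborel (\<lambda>x. M * exp (- (a / 2 * x\<^sup>2) + 0 * x))"
    using assms(1) by (intro integrable_mult_right integrable_gaussian_linear) simp
  then have "integrable lborel g"
    by (rule Bochner_Integration.integrable_bound) (use g_le \<open>M > 0\<close> in auto)
  from fourier_transform_eq_fourier_integral[OF assms(5,4) this fg]
  have "AE \<xi> in lborel. cmod (fourier_integral g \<xi>) \<le> M * exp (- b * \<xi>\<^sup>2 / 2)"
    by eventually_elim (metis assms(7))
  with assms g g_le have "AE x in lborel. g x = 0"
    by (intro hardy_uncertainty_borel[of a b g M]) auto
  with fg have "AE x in lborel. f x = 0"
    by eventually_elim simp
  then show ?thesis
    by (rule AE_completion)
qed

end
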